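(* A general two-dimensional system of second-order ODEs $$y''=\omega_1(x,y,z,y',z'),\qquad z''=\omega_2(x,y,z,y',z')$$ corresponds to a complex scalar equation $$u''=\omega(x,u,u')$$ if and only if $\omega_1$ and $\omega_2$ satisfy the Cauchy-Riemann equations $$\omega_{1,y}=\omega_{2,z},\quad \omega_{1,z}=-\omega_{2,y},\quad \omega_{1,y'}=\omega_{2,z'},\quad \omega_{1,z'}=-\omega_{2,y'}.$$
   Context: Here $x$ is a real independent variable, $y(x),z(x)$ are real dependent variables, prime denotes differentiation with respect to $x$, and $\omega_1,\omega_2$ are (smooth) real-valued functions of the real variables $(x,y,z,y',z')$, regarded as independent. A subscript after a comma denotes the partial derivative with respect to the indicated variable, e.g. $\omega_{1,y'}=\partial\omega_1/\partial y'$. The system is said to correspond to the complex equation $u''=\omega(x,u,u')$ if, with $u=y+iz$ (a complex function of the real variable $x$) and $u'=y'+iz'$, the system is obtained by splitting the complex equation into real and imaginary parts, i.e. $\omega(x,u,u')=\omega_1(x,y,z,y',z')+i\,\omega_2(x,y,z,y',z')$, where $\omega$ is complex analytic in its complex arguments $u$ and $u'$. *)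

theory Defs
  imports "HOL-Complex_Analysis.Complex_Analysis"
begin

text \<open>
  \<open>C_k_on k f S\<close> is intended for open \<open>S\<close>: \<open>f\<close> and its iterated directional derivatives of
  order less than \<open>k\<close> are (totally) differentiable on \<open>S\<close>, and those of order \<open>k\<close> are continuous.
\<close>

primrec C_k_on ::
  "nat \<Rightarrow> ('a::real_normed_vector \<Rightarrow> 'b::real_normed_vector) \<Rightarrow> 'a set \<Rightarrow> bool" where
  "C_k_on 0 f S \<longleftrightarrow> continuous_on S f"
| "C_k_on (Suc k) f S \<longleftrightarrow>
     (\<forall>p\<in>S. f differentiable (at p)) \<and>
     (\<forall>v. C_k_on k (\<lambda>p. frechet_derivative f (at p) v) S)"

definition smooth_on ::
  "('a::real_normed_vector \<Rightarrow> 'b::real_normed_vector) \<Rightarrow> 'a set \<Rightarrow> bool" where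
  "smooth_on f S \<longleftrightarrow> (\<forall>k. C_k_on k f S)"

text \<open>
  Joint analyticity in two complex variables: near every point of \<open>S\<close> the function is the sum of
  an (unconditionally, hence absolutely) convergent double power series.
\<close>

definition analytic2_on ::
  "(complex \<Rightarrow> complex \<Rightarrow> complex) \<Rightarrow> (complex \<times> complex) set \<Rightarrow> bool" where
  "analytic2_on f S \<longleftrightarrow>
     (\<forall>(u\<^sub>0, v\<^sub>0)\<in>S. \<exists>r>0. \<exists>a :: nat \<Rightarrow> nat \<Rightarrow> complex.
        \<forall>u\<in>ball u\<^sub>0 r. \<forall>v\<in>ball v\<^sub>0 r.
          ((\<lambda>(m, n). a m n * (u - u\<^sub>0) ^ m * (v - v\<^sub>0) ^ n) has_sum f u v) UNIV)"

text \<open>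
  Points of \<open>D\<close> are tuples \<open>(x, y, z, y', z')\<close>. The variables \<open>u = y + i z\<close> and \<open>u' = y' + i z'\<close>
  are the complex numbers \<open>Complex y z\<close> and \<open>Complex y' z'\<close>. No regularity of \<open>\<omega>\<close> in the real
  variable \<open>x\<close> is demanded beyond what it inherits from \<open>\<omega>\<^sub>1\<close> and \<open>\<omega>\<^sub>2\<close>.
\<close>

definition corresponds_to_complex_equation ::
  "(real \<times> real \<times> real \<times> real \<times> real) set \<Rightarrow>
   (real \<times> real \<times> real \<times> real \<times> real \<Rightarrow> real) \<Rightarrow>
   (real \<times> real \<times> real \<times> real \<times> real \<Rightarrow> real) \<Rightarrow>
   (real \<Rightarrow> complex \<Rightarrow> complex \<Rightarrow> complex) \<Rightarrow> bool" where
  "corresponds_to_complex_equation D \<omega>\<^sub>1 \<omega>\<^sub>2 \<omega> \<longleftrightarrow>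
     (\<forall>x. analytic2_on (\<omega> x)
            {(Complex y z, Complex y' z') | y z y' z'. (x, y, z, y', z') \<in> D}) \<and>
     (\<forall>(x, y, z, y', z')\<in>D.
        \<omega> x (Complex y z) (Complex y' z') =
          complex_of_real (\<omega>\<^sub>1 (x, y, z, y', z')) + \<i> * complex_of_real (\<omega>\<^sub>2 (x, y, z, y', z')))"

end

theory Submission
  imports Defs
begin

text \<open>
  Write \<open>F x u v\<close> for \<open>\<omega>\<^sub>1 + i \<omega>\<^sub>2\<close> as a function of the complex variables \<open>u = y + i z\<close> and
  \<open>v = y' + i z'\<close>. Any \<open>\<omega>\<close> that splits into the given system agrees with \<open>F x\<close> on the slice of \<open>D\<close>
  at \<open>x\<close>, and this slice is open, so the system comes from a complex equation exactly when every
  \<open>F x\<close> is jointly analytic there.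

  Three conditions on \<open>F x\<close> are equivalent. Joint analyticity gives complex differentiability in each
  variable, because freezing one variable at the center of a double power series leaves a power series
  in the other (\<open>analytic2_on_imp_separately_differentiable\<close>). Conversely, a continuous function that
  is complex differentiable in each variable is jointly analytic; this is Osgood's lemma
  (\<open>Osgood_analytic2_on\<close>), proved by expanding first in \<open>u\<close> and then expanding the coefficients, which
  are holomorphic functions of \<open>v\<close>. Finally, because \<open>\<omega>\<^sub>1\<close> and \<open>\<omega>\<^sub>2\<close> are totally differentiable,
  complex differentiability in \<open>u\<close> is the first pair of Cauchy-Riemann equations and complex
  differentiability in \<open>v\<close> is the second (\<open>field_differentiable_iff_Cauchy_Riemann\<close>).
\<close>

section \<open>The Cauchy-Riemann equations in one complex variable\<close>

lemma has_real_derivative_along_lines: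
  fixes P :: "complex \<Rightarrow> real"
  assumes "(P has_derivative P') (at (Complex a b))"
  shows "((\<lambda>t. P (Complex t b)) has_real_derivative P' 1) (at a)"
    and "((\<lambda>t. P (Complex a t)) has_real_derivative P' \<i>) (at b)"
proof -
  interpret P': bounded_linear P'
    using assms by (rule has_derivative_bounded_linear)
  have "((\<lambda>t. Complex t b) has_derivative (\<lambda>h. complex_of_real h)) (at a)"
    unfolding Complex_eq by (auto intro!: derivative_eq_intros)
  from diff_chain_at[OF this assms]
  show "((\<lambda>t. P (Complex t b)) has_real_derivative P' 1) (at a)"
    unfolding has_field_derivative_def o_def
    by (rule has_derivative_eq_rhs)
       (use P'.scaleR[of _ 1] in \<open>auto simp: fun_eq_iff scaleR_conv_of_real\<close>)
  have "((\<lambda>t. Complex a t) has_derivative (\<lambda>h. complex_of_real h * \<i>)) (at b)"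
    unfolding Complex_eq by (auto intro!: derivative_eq_intros)
  from diff_chain_at[OF this assms]
  show "((\<lambda>t. P (Complex a t)) has_real_derivative P' \<i>) (at b)"
    unfolding has_field_derivative_def o_def
    by (rule has_derivative_eq_rhs)
       (use P'.scaleR[of _ \<i>] in \<open>auto simp: fun_eq_iff scaleR_conv_of_real\<close>)
qed

text \<open>
  The real-linear total derivative \<open>L\<close> of \<open>P + i Q\<close> is multiplication by a complex number if and only
  if \<open>L i = i L 1\<close>, and the real and imaginary parts of this identity are the two Cauchy-Riemann
  equations.
\<close>

lemma field_differentiable_iff_Cauchy_Riemann:
  fixes P Q :: "complex \<Rightarrow> real"
  assumes "P differentiable (at (Complex a b))" and "Q differentiable (at (Complex a b))"
  shows "(\<lambda>w. complex_of_real (P w) + \<i> * complex_of_real (Q w)) field_differentiable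
           (at (Complex a b)) \<longleftrightarrow>
         deriv (\<lambda>t. P (Complex t b)) a = deriv (\<lambda>t. Q (Complex a t)) b \<and>
         deriv (\<lambda>t. P (Complex a t)) b = - deriv (\<lambda>t. Q (Complex t b)) a"
proof -
  obtain P' Q' where P': "(P has_derivative P') (at (Complex a b))"
    and Q': "(Q has_derivative Q') (at (Complex a b))"
    using assms unfolding differentiable_def by blast
  interpret P': bounded_linear P' using P' by (rule has_derivative_bounded_linear)
  interpret Q': bounded_linear Q' using Q' by (rule has_derivative_bounded_linear)
  let ?L = "\<lambda>h. complex_of_real (P' h) + \<i> * complex_of_real (Q' h)"
  have L: "((\<lambda>w. complex_of_real (P w) + \<i> * complex_of_real (Q w)) has_derivative ?L)
      (at (Complex a b))"
    by (auto intro!: derivative_eq_intros P' Q')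
  have split: "f h = Re h * f 1 + Im h * f \<i>" if "bounded_linear f"
    for f :: "complex \<Rightarrow> real" and h
  proof -
    interpret bounded_linear f by fact
    have "f h = f (Re h *\<^sub>R 1 + Im h *\<^sub>R \<i>)"
      by (rule arg_cong[where f = f]) (simp add: complex_eq_iff)
    then show ?thesis by (simp add: add scaleR)
  qed
  have "(\<exists>d. ?L = (*) d) \<longleftrightarrow> P' 1 = Q' \<i> \<and> P' \<i> = - Q' 1"
  proof
    assume "\<exists>d. ?L = (*) d"
    then obtain d where "?L 1 = d" "?L \<i> = d * \<i>"
      by (metis mult.right_neutral)
    then show "P' 1 = Q' \<i> \<and> P' \<i> = - Q' 1"
      by (auto simp: complex_eq_iff)
  next
    assume CR: "P' 1 = Q' \<i> \<and> P' \<i> = - Q' 1"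
    have "?L h = Complex (P' 1) (Q' 1) * h" for h
      using split[OF P'.bounded_linear_axioms, of h] split[OF Q'.bounded_linear_axioms, of h] CR
      by (simp add: complex_eq_iff algebra_simps)
    then show "\<exists>d. ?L = (*) d" by blast
  qed
  moreover have "(\<lambda>w. complex_of_real (P w) + \<i> * complex_of_real (Q w)) field_differentiable
           (at (Complex a b)) \<longleftrightarrow> (\<exists>d. ?L = (*) d)"
    unfolding field_differentiable_def has_field_derivative_def
    by (metis L has_derivative_unique)
  ultimately show ?thesis
    using has_real_derivative_along_lines[OF P'] has_real_derivative_along_lines[OF Q']
    by (simp add: DERIV_imp_deriv)
qed

section \<open>Osgood's lemma\<close>

text \<open>
  By Fubini, the integral of \<open>v \<mapsto> \<integral>\<^sub>g h v \<zeta> d\<zeta>\<close> over the boundary of a triangle is the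
  integral over \<open>\<zeta>\<close> of boundary integrals of \<open>v \<mapsto> h v \<zeta>\<close>. These vanish by Cauchy's theorem, and
  Morera's theorem applies.
\<close>

lemma holomorphic_on_parametric_contour_integral:
  assumes "open S" and cont: "continuous_on (S \<times> path_image g) (\<lambda>(v, \<zeta>). h v \<zeta>)"
    and hol: "\<And>\<zeta>. \<zeta> \<in> path_image g \<Longrightarrow> (\<lambda>v. h v \<zeta>) holomorphic_on S"
    and g: "valid_path g" "continuous_on {0..1} (\<lambda>t. vector_derivative g (at t))"
  shows "(\<lambda>v. contour_integral g (h v)) holomorphic_on S"
proof -
  have g_cont: "continuous_on {0..1} g"
    using g(1) by (simp add: valid_path_imp_path flip: path_def)
  have cont_int: "continuous_on S (\<lambda>v. contour_integral g (h v))"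
  proof -
    have "continuous_on (S \<times> {0..1}) (\<lambda>(v, t). h v (g t))"
      unfolding case_prod_unfold
      by (intro continuous_intros continuous_on_compose2[OF cont[unfolded case_prod_unfold],
            where f = "\<lambda>p. (fst p, g (snd p))", simplified]
            continuous_on_compose2[OF g_cont])
         (auto simp: path_image_def)
    moreover have "continuous_on (S \<times> {0..1}) (\<lambda>p. vector_derivative g (at (snd p)))"
      by (intro continuous_on_compose2[OF g(2)] continuous_intros) auto
    ultimately have "continuous_on (S \<times> cbox 0 1)
        (\<lambda>(v, t). h v (g t) * vector_derivative g (at t))"
      unfolding case_prod_unfold by (auto intro!: continuous_intros)
    then show ?thesis
      unfolding contour_integral_integral
      using integral_continuous_on_param by fastforce
  qed
  have swap: "contour_integral (linepath a b) (\<lambda>v. contour_integral g (h v)) =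
      contour_integral g (\<lambda>\<zeta>. contour_integral (linepath a b) (\<lambda>v. h v \<zeta>))"
    and int: "(\<lambda>\<zeta>. contour_integral (linepath a b) (\<lambda>v. h v \<zeta>)) contour_integrable_on g"
    if "closed_segment a b \<subseteq> S" for a b
  proof -
    have c: "continuous_on (path_image (linepath a b) \<times> path_image g) (\<lambda>(v, \<zeta>). h v \<zeta>)"
      using that by (intro continuous_on_subset[OF cont]) auto
    show "contour_integral (linepath a b) (\<lambda>v. contour_integral g (h v)) =
      contour_integral g (\<lambda>\<zeta>. contour_integral (linepath a b) (\<lambda>v. h v \<zeta>))"
      by (rule contour_integral_swap[OF c]) (use g in auto)
    have "continuous_on (path_image g) (\<lambda>\<zeta>. contour_integral (linepath a b) (\<lambda>v. h v \<zeta>))"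
    proof -
      have "continuous_on (path_image g \<times> cbox 0 1)
        (\<lambda>(\<zeta>, t). h (linepath a b t) \<zeta> * vector_derivative (linepath a b) (at t))"
        unfolding case_prod_unfold vector_derivative_linepath_at
        by (intro continuous_intros continuous_on_compose2[OF c[unfolded case_prod_unfold],
              where f = "\<lambda>p. (linepath a b (snd p), fst p)", simplified]
              continuous_on_compose2[OF continuous_on_linepath])
           (auto simp: linepath_in_path)
      then show ?thesis
        unfolding contour_integral_integral
        using integral_continuous_on_param by fastforce
    qed
    then have "continuous_on {0..1} (\<lambda>t. contour_integral (linepath a b) (\<lambda>v. h v (g t)))"
      by (rule continuous_on_compose2[OF _ g_cont]) (auto simp: path_image_def)
    then show "(\<lambda>\<zeta>. contour_integral (linepath a b) (\<lambda>v. h v \<zeta>)) contour_integrable_on g"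
      unfolding contour_integrable_on
      by (intro integrable_continuous_real continuous_on_mult g(2))
  qed
  have "(\<lambda>v. contour_integral g (h v)) analytic_on S"
  proof (rule Morera_triangle[OF cont_int \<open>open S\<close>], intro impI)
    fix a b c assume abc: "convex hull {a, b, c} \<subseteq> S"
    then have seg: "closed_segment a b \<subseteq> S" "closed_segment b c \<subseteq> S" "closed_segment c a \<subseteq> S"
      by (meson closed_segment_subset_convex_hull dual_order.trans hull_inc insertI1 insertI2)+
    have zero: "contour_integral (linepath a b) (\<lambda>v. h v \<zeta>) +
        contour_integral (linepath b c) (\<lambda>v. h v \<zeta>) +
        contour_integral (linepath c a) (\<lambda>v. h v \<zeta>) = 0" if "\<zeta> \<in> path_image g" for \<zeta>
    proof -
      have "(\<lambda>v. h v \<zeta>) holomorphic_on convex hull {a, b, c}"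
        using hol[OF that] abc by (rule holomorphic_on_subset)
      from Cauchy_theorem_triangle[OF this] show ?thesis
        by (rule has_chain_integral_chain_integral3)
    qed
    have "contour_integral (linepath a b) (\<lambda>v. contour_integral g (h v)) +
        contour_integral (linepath b c) (\<lambda>v. contour_integral g (h v)) +
        contour_integral (linepath c a) (\<lambda>v. contour_integral g (h v)) =
        contour_integral g (\<lambda>\<zeta>. contour_integral (linepath a b) (\<lambda>v. h v \<zeta>) +
        contour_integral (linepath b c) (\<lambda>v. h v \<zeta>) +
        contour_integral (linepath c a) (\<lambda>v. h v \<zeta>))"
      using seg by (simp add: swap int contour_integral_add contour_integrable_add)
    also have "\<dots> = contour_integral g (\<lambda>\<zeta>. 0)"
      using zero by (intro contour_integral_cong) auto
    finally show "contour_integral (linepath a b) (\<lambda>v. contour_integral g (h v)) +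
        contour_integral (linepath b c) (\<lambda>v. contour_integral g (h v)) +
        contour_integral (linepath c a) (\<lambda>v. contour_integral g (h v)) = 0"
      by simp
  qed
  then show ?thesis by (rule analytic_imp_holomorphic)
qed

text \<open>
  Cauchy's integral formula turns the derivative in \<open>u\<close> at the center into an integral over a fixed
  circle, in which \<open>v\<close> is only a parameter. In Osgood's lemma this shows that the Taylor coefficients
  in \<open>u\<close> depend holomorphically on \<open>v\<close>.
\<close>

lemma holomorphic_on_partial_higher_deriv:
  assumes "0 < R" and "open T"
    and cont: "continuous_on (cball u\<^sub>0 R \<times> T) (\<lambda>(u, v). F u v)"
    and hol1: "\<And>v. v \<in> T \<Longrightarrow> (\<lambda>u. F u v) holomorphic_on ball u\<^sub>0 R"
    and hol2: "\<And>u. u \<in> cball u\<^sub>0 R \<Longrightarrow> F u holomorphic_on T"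
  shows "(\<lambda>v. (deriv ^^ m) (\<lambda>u. F u v) u\<^sub>0) holomorphic_on T"
proof -
  let ?h = "\<lambda>v \<zeta>. F \<zeta> v / (\<zeta> - u\<^sub>0) ^ Suc m"
  have [simp]: "path_image (circlepath u\<^sub>0 R) = sphere u\<^sub>0 R" using \<open>0 < R\<close> by simp
  have nz: "\<zeta> \<noteq> u\<^sub>0" if "\<zeta> \<in> sphere u\<^sub>0 R" for \<zeta> using that \<open>0 < R\<close> by auto
  have "continuous_on (T \<times> sphere u\<^sub>0 R) (\<lambda>p. F (snd p) (fst p))"
    by (rule continuous_on_compose2[OF cont[unfolded case_prod_unfold],
            where f = "\<lambda>p. (snd p, fst p)", simplified])
       (auto intro!: continuous_intros)
  then have h_cont: "continuous_on (T \<times> path_image (circlepath u\<^sub>0 R)) (\<lambda>(v, \<zeta>). ?h v \<zeta>)"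
    unfolding case_prod_unfold by (intro continuous_intros) (use nz \<open>0 < R\<close> in auto)
  have "(\<lambda>v. contour_integral (circlepath u\<^sub>0 R) (?h v)) holomorphic_on T"
  proof (rule holomorphic_on_parametric_contour_integral[OF \<open>open T\<close> h_cont])
    show "(\<lambda>v. ?h v \<zeta>) holomorphic_on T" if "\<zeta> \<in> path_image (circlepath u\<^sub>0 R)" for \<zeta>
      using that nz \<open>0 < R\<close> by (intro holomorphic_intros hol2) auto
    show "continuous_on {0..1} (\<lambda>t. vector_derivative (circlepath u\<^sub>0 R) (at t))"
      unfolding vector_derivative_circlepath by (intro continuous_intros)
  qed auto
  then have "(\<lambda>v. fact m / (2 * pi * \<i>) * contour_integral (circlepath u\<^sub>0 R) (?h v)) holomorphic_on T"
    by (intro holomorphic_intros)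
  moreover have "fact m / (2 * pi * \<i>) * contour_integral (circlepath u\<^sub>0 R) (?h v) =
      (deriv ^^ m) (\<lambda>u. F u v) u\<^sub>0" if "v \<in> T" for v
  proof (rule Cauchy_higher_derivative_integral_circlepath(2)[symmetric])
    show "continuous_on (cball u\<^sub>0 R) (\<lambda>u. F u v)"
      by (rule continuous_on_compose2[OF cont[unfolded case_prod_unfold],
            where f = "\<lambda>u. (u, v)", simplified])
         (use that in \<open>auto intro!: continuous_intros\<close>)
  qed (use hol1[OF that] \<open>0 < R\<close> in auto)
  ultimately show ?thesis by (simp cong: holomorphic_cong)
qed

lemma summable_double_geometric:
  fixes s t :: real
  assumes "0 \<le> s" "s < 1" "0 \<le> t" "t < 1"
  shows "(\<lambda>(m, n). s ^ m * t ^ n) summable_on (UNIV :: (nat \<times> nat) set)"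
proof -
  have "(\<lambda>(m, n). s ^ m * t ^ n) summable_on (SIGMA m:UNIV. (UNIV :: nat set))"
  proof (rule summable_on_SigmaI)
    show "((\<lambda>n. case (m, n) of (m, n) \<Rightarrow> s ^ m * t ^ n) has_sum s ^ m * (1 / (1 - t))) UNIV" for m
      unfolding prod.case
      using assms by (intro has_sum_cmult_right norm_summable_imp_has_sum geometric_sums)
        (auto simp: norm_power intro: summable_geometric)
    show "(\<lambda>m. s ^ m * (1 / (1 - t))) summable_on UNIV"
      using assms by (auto intro!: summable_on_cmult_left norm_summable_imp_summable_on
          summable_geometric simp: norm_power)
  qed (use assms in auto)
  then show ?thesis by simp
qed

text \<open>
  Expand \<open>F u v = \<Sum>m. c m v * (u - u\<^sub>0)^m\<close> and then \<open>c m v = \<Sum>n. a m n * (v - v\<^sub>0)^n\<close>. If \<open>M\<close>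
  bounds \<open>F\<close> on a closed bidisc of radius \<open>R\<close>, Cauchy's estimates applied twice give
  \<open>\<bar>a m n\<bar> \<le> M / R^(m + n)\<close>. The double series is therefore dominated by a double geometric
  series, and its unordered sum equals the iterated one.
\<close>

lemma Osgood_analytic2_on:
  assumes "open S" and cont: "continuous_on S (\<lambda>(u, v). F u v)"
    and diff1: "\<And>u v. (u, v) \<in> S \<Longrightarrow> (\<lambda>u. F u v) field_differentiable (at u)"
    and diff2: "\<And>u v. (u, v) \<in> S \<Longrightarrow> F u field_differentiable (at v)"
  shows "analytic2_on F S"
  unfolding analytic2_on_def
proof clarify
  fix u\<^sub>0 v\<^sub>0 assume "(u\<^sub>0, v\<^sub>0) \<in> S"
  with \<open>open S\<close> obtain A B where AB: "open A" "open B" "u\<^sub>0 \<in> A" "v\<^sub>0 \<in> B" "A \<times> B \<subseteq> S"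
    by (metis open_prod_elim mem_Sigma_iff)
  then obtain r1 r2 where r: "r1 > 0" "cball u\<^sub>0 r1 \<subseteq> A" "r2 > 0" "cball v\<^sub>0 r2 \<subseteq> B"
    by (meson open_contains_cball)
  define R where "R = min r1 r2"
  have "R > 0" using r by (simp add: R_def)
  have sub: "cball u\<^sub>0 R \<times> B \<subseteq> S" "cball v\<^sub>0 R \<subseteq> B"
    using AB r by (auto simp: R_def)
  have hol1: "(\<lambda>u. F u v) holomorphic_on cball u\<^sub>0 R" if "v \<in> B" for v
    using that sub(1) unfolding holomorphic_on_def
    by (intro ballI field_differentiable_at_within[OF diff1]) blast
  have hol2: "F u holomorphic_on B" if "u \<in> cball u\<^sub>0 R" for u
    using that sub(1) unfolding holomorphic_on_def
    by (intro ballI field_differentiable_at_within[OF diff2]) blast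
  define c where "c m v = (deriv ^^ m) (\<lambda>u. F u v) u\<^sub>0 / fact m" for m v
  define a where "a m n = (deriv ^^ n) (c m) v\<^sub>0 / fact n" for m n
  have hol_c: "c m holomorphic_on B" for m
    unfolding c_def using \<open>R > 0\<close> AB(2) sub(1)
    by (intro holomorphic_intros holomorphic_on_partial_higher_deriv[where R = R])
       (auto intro: continuous_on_subset[OF cont] holomorphic_on_subset[OF hol1] hol2)
  have "compact ((\<lambda>(u, v). F u v) ` (cball u\<^sub>0 R \<times> cball v\<^sub>0 R))"
    using sub by (intro compact_continuous_image continuous_on_subset[OF cont] compact_Times) auto
  then obtain M where M: "norm (F u v) \<le> M" if "u \<in> cball u\<^sub>0 R" "v \<in> cball v\<^sub>0 R" for u v
    by (fastforce dest!: compact_imp_bounded simp: bounded_iff)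
  have c_le: "norm (c m v) \<le> M / R ^ m" if "v \<in> cball v\<^sub>0 R" for m v
  proof -
    have "norm ((deriv ^^ m) (\<lambda>u. F u v) u\<^sub>0) \<le> fact m * M / R ^ m"
    proof (rule Cauchy_inequality)
      have hol: "(\<lambda>u. F u v) holomorphic_on cball u\<^sub>0 R" using that sub(2) by (blast intro: hol1)
      then show "(\<lambda>u. F u v) holomorphic_on ball u\<^sub>0 R"
        by (rule holomorphic_on_subset) auto
      show "continuous_on (cball u\<^sub>0 R) (\<lambda>u. F u v)"
        using hol by (rule holomorphic_on_imp_continuous_on)
    qed (use that \<open>R > 0\<close> in \<open>simp_all add: M dist_norm\<close>)
    then show ?thesis by (simp add: c_def norm_divide field_simps)
  qed
  have a_le: "norm (a m n) \<le> M / R ^ m / R ^ n" for m n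
  proof -
    have "norm ((deriv ^^ n) (c m) v\<^sub>0) \<le> fact n * (M / R ^ m) / R ^ n"
    proof (rule Cauchy_inequality)
      have hol: "c m holomorphic_on cball v\<^sub>0 R" using hol_c sub(2) by (rule holomorphic_on_subset)
      then show "c m holomorphic_on ball v\<^sub>0 R"
        by (rule holomorphic_on_subset) auto
      show "continuous_on (cball v\<^sub>0 R) (c m)"
        using hol by (rule holomorphic_on_imp_continuous_on)
    qed (use \<open>R > 0\<close> in \<open>simp_all add: c_le dist_norm\<close>)
    then show ?thesis by (simp add: a_def norm_divide field_simps)
  qed
  show "\<exists>r>0. \<exists>a. \<forall>u\<in>ball u\<^sub>0 r. \<forall>v\<in>ball v\<^sub>0 r.
      ((\<lambda>(m, n). a m n * (u - u\<^sub>0) ^ m * (v - v\<^sub>0) ^ n) has_sum F u v) UNIV"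
  proof (intro exI[of _ R] exI[of _ a] conjI ballI)
    fix u v assume uv: "u \<in> ball u\<^sub>0 R" "v \<in> ball v\<^sub>0 R"
    define s t where "s = norm (u - u\<^sub>0) / R" and "t = norm (v - v\<^sub>0) / R"
    have st: "0 \<le> s" "s < 1" "0 \<le> t" "t < 1"
      using uv \<open>R > 0\<close> by (auto simp: s_def t_def dist_norm norm_minus_commute)
    let ?f = "\<lambda>(m, n). a m n * (u - u\<^sub>0) ^ m * (v - v\<^sub>0) ^ n"
    have bound: "norm (?f p) \<le> (case p of (m, n) \<Rightarrow> M * (s ^ m * t ^ n))" for p
    proof (cases p)
      case (Pair m n)
      have "norm (a m n) * (norm (u - u\<^sub>0) ^ m * norm (v - v\<^sub>0) ^ n) \<le>
          M / R ^ m / R ^ n * (norm (u - u\<^sub>0) ^ m * norm (v - v\<^sub>0) ^ n)"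
        by (intro mult_right_mono a_le) auto
      then show ?thesis
        by (simp add: Pair s_def t_def norm_mult norm_power power_divide mult_ac)
    qed
    have abs: "(\<lambda>p. norm (?f p)) summable_on UNIV"
      using summable_on_cmult_right[OF summable_double_geometric[OF st], of M]
      by (intro Infinite_Sum.abs_summable_on_comparison_test'[OF _ bound]) (simp add: case_prod_unfold)
    have "(?f has_sum F u v) (SIGMA m:UNIV. UNIV)"
    proof (rule has_sum_SigmaI)
      show "?f summable_on (SIGMA m:UNIV. UNIV)"
        using abs_summable_summable[OF abs] by simp
      have a_sums: "(\<lambda>n. a m n * (v - v\<^sub>0) ^ n) sums c m v" for m
        unfolding a_def
        by (rule holomorphic_power_series[OF holomorphic_on_subset[OF hol_c] uv(2)])
           (use sub in auto)
      show "((\<lambda>n. ?f (m, n)) has_sum c m v * (u - u\<^sub>0) ^ m) UNIV" for m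
      proof (rule norm_summable_imp_has_sum)
        show "(\<lambda>n. ?f (m, n)) sums (c m v * (u - u\<^sub>0) ^ m)"
          using sums_mult2[OF a_sums, of m "(u - u\<^sub>0) ^ m"] by (simp add: mult_ac)
        have "summable (\<lambda>n. M * (s ^ m * t ^ n))"
          using st by (intro summable_mult summable_geometric) auto
        then show "summable (\<lambda>n. norm (?f (m, n)))"
          by (rule summable_comparison_test') (use bound[of "(m, n)" for n] in auto)
      qed
      have "v \<in> cball v\<^sub>0 R" using uv by auto
      show "((\<lambda>m. c m v * (u - u\<^sub>0) ^ m) has_sum F u v) UNIV"
      proof (rule norm_summable_imp_has_sum)
        show "(\<lambda>m. c m v * (u - u\<^sub>0) ^ m) sums F u v"
          unfolding c_def
          by (rule holomorphic_power_series[OF holomorphic_on_subset[OF hol1] uv(1)])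
             (use sub \<open>v \<in> cball v\<^sub>0 R\<close> in auto)
        have c_term_le: "norm (c m v * (u - u\<^sub>0) ^ m) \<le> M * s ^ m" for m
          using mult_right_mono[OF c_le[OF \<open>v \<in> cball v\<^sub>0 R\<close>, of m],
              of "norm (u - u\<^sub>0) ^ m"]
          by (simp add: s_def norm_mult norm_power power_divide)
        have "summable (\<lambda>m. M * s ^ m)"
          using st by (intro summable_mult summable_geometric) auto
        then show "summable (\<lambda>m. norm (c m v * (u - u\<^sub>0) ^ m))"
          by (rule summable_comparison_test') (simp only: real_norm_def abs_norm_cancel c_term_le)
      qed
    qed
    then show "(?f has_sum F u v) UNIV" by simp
  qed fact
qed

section \<open>Joint analyticity and separate differentiability\<close>

lemma power_series_field_differentiable_at_center:
  fixes f :: "complex \<Rightarrow> complex"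
  assumes "0 < r" and "\<And>w. w \<in> ball z r \<Longrightarrow> (\<lambda>n. b n * (w - z) ^ n) sums f w"
  shows "f field_differentiable (at z)"
proof -
  have "f holomorphic_on ball z r"
    using assms(2) by (rule power_series_holomorphic)
  then show ?thesis
    using \<open>0 < r\<close> by (auto intro: holomorphic_on_imp_differentiable_at)
qed

lemma analytic2_on_imp_separately_differentiable:
  assumes "analytic2_on F S" and "(u\<^sub>0, v\<^sub>0) \<in> S"
  shows "(\<lambda>u. F u v\<^sub>0) field_differentiable (at u\<^sub>0)" and "F u\<^sub>0 field_differentiable (at v\<^sub>0)"
proof -
  obtain r a where "r > 0" and sum: "\<And>u v. u \<in> ball u\<^sub>0 r \<Longrightarrow> v \<in> ball v\<^sub>0 r \<Longrightarrow>
      ((\<lambda>(m, n). a m n * (u - u\<^sub>0) ^ m * (v - v\<^sub>0) ^ n) has_sum F u v) UNIV"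
    using assms unfolding analytic2_on_def by blast
  have "(\<lambda>m. a m 0 * (u - u\<^sub>0) ^ m) sums F u v\<^sub>0" if "u \<in> ball u\<^sub>0 r" for u
  proof (rule has_sum_imp_sums)
    \<comment> \<open>Only \<open>n = 0\<close> survives at \<open>v = v\<^sub>0\<close>, where the last factor is \<open>0^0 = 1\<close>.\<close>
    have "((\<lambda>(m, n). a m n * (u - u\<^sub>0) ^ m * (v\<^sub>0 - v\<^sub>0) ^ n) has_sum F u v\<^sub>0)
        (range (\<lambda>m. (m, 0)))"
      by (rule has_sum_cong_neutral[THEN iffD1, OF _ _ _ sum[OF that]])
         (use \<open>r > 0\<close> in auto)
    then show "((\<lambda>m. a m 0 * (u - u\<^sub>0) ^ m) has_sum F u v\<^sub>0) UNIV"
      by (subst (asm) has_sum_reindex) (auto simp: inj_on_def o_def)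
  qed
  then show "(\<lambda>u. F u v\<^sub>0) field_differentiable (at u\<^sub>0)"
    by (rule power_series_field_differentiable_at_center[OF \<open>r > 0\<close>])
  have "(\<lambda>n. a 0 n * (v - v\<^sub>0) ^ n) sums F u\<^sub>0 v" if "v \<in> ball v\<^sub>0 r" for v
  proof (rule has_sum_imp_sums)
    have "((\<lambda>(m, n). a m n * (u\<^sub>0 - u\<^sub>0) ^ m * (v - v\<^sub>0) ^ n) has_sum F u\<^sub>0 v)
        (range (\<lambda>n. (0, n)))"
      by (rule has_sum_cong_neutral[THEN iffD1, OF _ _ _ sum[OF _ that]])
         (use \<open>r > 0\<close> in auto)
    then show "((\<lambda>n. a 0 n * (v - v\<^sub>0) ^ n) has_sum F u\<^sub>0 v) UNIV"
      by (subst (asm) has_sum_reindex) (auto simp: inj_on_def o_def)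
  qed
  then show "F u\<^sub>0 field_differentiable (at v\<^sub>0)"
    by (rule power_series_field_differentiable_at_center[OF \<open>r > 0\<close>])
qed

lemma analytic2_on_iff_separately_differentiable:
  assumes "open S" and "continuous_on S (\<lambda>(u, v). F u v)"
  shows "analytic2_on F S \<longleftrightarrow>
    (\<forall>(u, v)\<in>S. (\<lambda>u. F u v) field_differentiable (at u) \<and> F u field_differentiable (at v))"
  using Osgood_analytic2_on[OF assms] analytic2_on_imp_separately_differentiable[of F S] by blast

text \<open>
  \<open>analytic2_on\<close> refers to values on whole bidiscs around points of the set; openness ensures that
  small bidiscs stay in the set, so that the values on the set decide.
\<close>

lemma analytic2_on_cong_open:
  assumes "open S" and "\<And>u v. (u, v) \<in> S \<Longrightarrow> F u v = G u v"
  shows "analytic2_on F S \<longleftrightarrow> analytic2_on G S"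
proof -
  have "analytic2_on G S" if F: "analytic2_on F S" and eq: "\<And>u v. (u, v) \<in> S \<Longrightarrow> F u v = G u v"
    for F G
    unfolding analytic2_on_def
  proof clarify
    fix u\<^sub>0 v\<^sub>0 assume uv: "(u\<^sub>0, v\<^sub>0) \<in> S"
    obtain r a where "r > 0" and sum: "\<And>u v. u \<in> ball u\<^sub>0 r \<Longrightarrow> v \<in> ball v\<^sub>0 r \<Longrightarrow>
        ((\<lambda>(m, n). a m n * (u - u\<^sub>0) ^ m * (v - v\<^sub>0) ^ n) has_sum F u v) UNIV"
      using F uv unfolding analytic2_on_def by blast
    obtain A B where AB: "open A" "open B" "u\<^sub>0 \<in> A" "v\<^sub>0 \<in> B" "A \<times> B \<subseteq> S"
      using \<open>open S\<close> uv by (metis open_prod_elim mem_Sigma_iff)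
    then obtain r1 r2 where r: "r1 > 0" "ball u\<^sub>0 r1 \<subseteq> A" "r2 > 0" "ball v\<^sub>0 r2 \<subseteq> B"
      by (meson open_contains_ball)
    define \<rho> where "\<rho> = min r (min r1 r2)"
    have "((\<lambda>(m, n). a m n * (u - u\<^sub>0) ^ m * (v - v\<^sub>0) ^ n) has_sum G u v) UNIV"
      if uv': "u \<in> ball u\<^sub>0 \<rho>" "v \<in> ball v\<^sub>0 \<rho>" for u v
    proof -
      have "u \<in> A" "v \<in> B" using uv' r by (auto simp: \<rho>_def)
      then have "F u v = G u v" using AB(5) by (intro eq) blast
      then show ?thesis using sum[of u v] uv' by (simp add: \<rho>_def)
    qed
    moreover have "\<rho> > 0" using \<open>r > 0\<close> r by (simp add: \<rho>_def)
    ultimately show "\<exists>r>0. \<exists>a. \<forall>u\<in>ball u\<^sub>0 r. \<forall>v\<in>ball v\<^sub>0 r.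
        ((\<lambda>(m, n). a m n * (u - u\<^sub>0) ^ m * (v - v\<^sub>0) ^ n) has_sum G u v) UNIV"
      by blast
  qed
  from this[of F G] this[of G F] show ?thesis using assms(2) by auto
qed

section \<open>Systems that come from a complex equation\<close>

theorem theorem1:
  fixes \<omega>\<^sub>1 \<omega>\<^sub>2 :: "real \<times> real \<times> real \<times> real \<times> real \<Rightarrow> real"
    and D :: "(real \<times> real \<times> real \<times> real \<times> real) set"
  assumes "open D"
    and "smooth_on \<omega>\<^sub>1 D"
    and "smooth_on \<omega>\<^sub>2 D"
  shows "(\<exists>\<omega>. corresponds_to_complex_equation D \<omega>\<^sub>1 \<omega>\<^sub>2 \<omega>) \<longleftrightarrow>
    (\<forall>x y z y' z'. (x, y, z, y', z') \<in> D \<longrightarrow>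
       deriv (\<lambda>t. \<omega>\<^sub>1 (x, t, z, y', z')) y = deriv (\<lambda>t. \<omega>\<^sub>2 (x, y, t, y', z')) z \<and>
       deriv (\<lambda>t. \<omega>\<^sub>1 (x, y, t, y', z')) z = - deriv (\<lambda>t. \<omega>\<^sub>2 (x, t, z, y', z')) y \<and>
       deriv (\<lambda>t. \<omega>\<^sub>1 (x, y, z, t, z')) y' = deriv (\<lambda>t. \<omega>\<^sub>2 (x, y, z, y', t)) z' \<and>
       deriv (\<lambda>t. \<omega>\<^sub>1 (x, y, z, y', t)) z' = - deriv (\<lambda>t. \<omega>\<^sub>2 (x, y, z, t, z')) y')"
proof -
  let ?real = "\<lambda>x (u, v). (x, Re u, Im u, Re v, Im v)"
  \<comment> \<open>\<open>F\<close> is the only candidate for \<open>\<omega>\<close> on \<open>D\<close>, and \<open>S x\<close> is the slice of \<open>D\<close> at \<open>x\<close>.\<close>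
  define F where "F x u v = complex_of_real (\<omega>\<^sub>1 (?real x (u, v))) +
    \<i> * complex_of_real (\<omega>\<^sub>2 (?real x (u, v)))" for x u v
  define S where "S x = ?real x -` D" for x
  have S_eq: "{(Complex y z, Complex y' z') | y z y' z'. (x, y, z, y', z') \<in> D} = S x" for x
    unfolding S_def by (auto, metis complex.collapse)
  have diff: "\<omega>\<^sub>1 differentiable (at p)" "\<omega>\<^sub>2 differentiable (at p)" if "p \<in> D" for p
    using that assms(2,3)[unfolded smooth_on_def, rule_format, of 1] by auto
  have open_S: "open (S x)" for x
    unfolding S_def case_prod_unfold
    by (intro open_vimage[OF \<open>open D\<close>] continuous_intros)
  have cont_F: "continuous_on (S x) (\<lambda>(u, v). F x u v)" for x
  proof -
    have "continuous_on D \<omega>\<^sub>1" "continuous_on D \<omega>\<^sub>2"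
      using assms(2,3)[unfolded smooth_on_def, rule_format, of 0] by auto
    then have "continuous_on (S x) (\<lambda>q. \<omega>\<^sub>1 (?real x q))" "continuous_on (S x) (\<lambda>q. \<omega>\<^sub>2 (?real x q))"
      unfolding S_def case_prod_unfold
      by (auto elim!: continuous_on_compose2 intro!: continuous_intros)
    then show ?thesis
      unfolding F_def case_prod_unfold by (auto intro!: continuous_intros)
  qed
  have CR_u: "(\<lambda>u. F x u (Complex y' z')) field_differentiable (at (Complex y z)) \<longleftrightarrow>
       deriv (\<lambda>t. \<omega>\<^sub>1 (x, t, z, y', z')) y = deriv (\<lambda>t. \<omega>\<^sub>2 (x, y, t, y', z')) z \<and>
       deriv (\<lambda>t. \<omega>\<^sub>1 (x, y, t, y', z')) z = - deriv (\<lambda>t. \<omega>\<^sub>2 (x, t, z, y', z')) y"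
    if "(x, y, z, y', z') \<in> D" for x y z y' z'
  proof -
    have "(\<lambda>u. (x, Re u, Im u, y', z')) differentiable (at (Complex y z))"
      unfolding differentiable_def
      by (rule exI, (rule derivative_intros | rule bounded_linear_imp_has_derivative
              | rule bounded_linear_Re bounded_linear_Im)+)
    then have "(\<lambda>u. \<omega> (x, Re u, Im u, y', z')) differentiable (at (Complex y z))"
      if "\<omega> differentiable (at (x, y, z, y', z'))" for \<omega> :: "_ \<Rightarrow> real"
      using differentiable_chain_at[of "\<lambda>u. (x, Re u, Im u, y', z')" "Complex y z" \<omega>] that
      by (simp add: o_def)
    from field_differentiable_iff_Cauchy_Riemann[OF this this, OF diff[OF that]]
    show ?thesis by (simp add: F_def)
  qed
  have CR_v: "F x (Complex y z) field_differentiable (at (Complex y' z')) \<longleftrightarrow>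
       deriv (\<lambda>t. \<omega>\<^sub>1 (x, y, z, t, z')) y' = deriv (\<lambda>t. \<omega>\<^sub>2 (x, y, z, y', t)) z' \<and>
       deriv (\<lambda>t. \<omega>\<^sub>1 (x, y, z, y', t)) z' = - deriv (\<lambda>t. \<omega>\<^sub>2 (x, y, z, t, z')) y'"
    if "(x, y, z, y', z') \<in> D" for x y z y' z'
  proof -
    have "(\<lambda>v. (x, y, z, Re v, Im v)) differentiable (at (Complex y' z'))"
      unfolding differentiable_def
      by (rule exI, (rule derivative_intros | rule bounded_linear_imp_has_derivative
              | rule bounded_linear_Re bounded_linear_Im)+)
    then have "(\<lambda>v. \<omega> (x, y, z, Re v, Im v)) differentiable (at (Complex y' z'))"
      if "\<omega> differentiable (at (x, y, z, y', z'))" for \<omega> :: "_ \<Rightarrow> real"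
      using differentiable_chain_at[of "\<lambda>v. (x, y, z, Re v, Im v)" "Complex y' z'" \<omega>] that
      by (simp add: o_def)
    from field_differentiable_iff_Cauchy_Riemann[OF this this, OF diff[OF that]]
    show ?thesis by (simp add: F_def[abs_def])
  qed
  have F_corr: "corresponds_to_complex_equation D \<omega>\<^sub>1 \<omega>\<^sub>2 \<omega> \<longleftrightarrow>
      (\<forall>x. analytic2_on (F x) (S x)) \<and> (\<forall>x u v. (u, v) \<in> S x \<longrightarrow> \<omega> x u v = F x u v)" for \<omega>
  proof -
    have "(\<forall>(x, y, z, y', z')\<in>D. \<omega> x (Complex y z) (Complex y' z') =
          complex_of_real (\<omega>\<^sub>1 (x, y, z, y', z')) + \<i> * complex_of_real (\<omega>\<^sub>2 (x, y, z, y', z')))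
      \<longleftrightarrow> (\<forall>x u v. (u, v) \<in> S x \<longrightarrow> \<omega> x u v = F x u v)"
      by (auto simp: F_def S_eq[symmetric])
    then show ?thesis
      unfolding corresponds_to_complex_equation_def S_eq
      using analytic2_on_cong_open[OF open_S, of _ "\<omega> _" "F _"] by blast
  qed
  have "(\<exists>\<omega>. corresponds_to_complex_equation D \<omega>\<^sub>1 \<omega>\<^sub>2 \<omega>) \<longleftrightarrow> (\<forall>x. analytic2_on (F x) (S x))"
    unfolding F_corr by blast
  also have "\<dots> \<longleftrightarrow> (\<forall>x y z y' z'. (x, y, z, y', z') \<in> D \<longrightarrow>
      (\<lambda>u. F x u (Complex y' z')) field_differentiable (at (Complex y z)) \<and>
      F x (Complex y z) field_differentiable (at (Complex y' z')))"
    unfolding analytic2_on_iff_separately_differentiable[OF open_S cont_F]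
    by (auto simp: S_eq[symmetric])
  finally show ?thesis
    by (simp add: CR_u CR_v)
qed

end
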